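(* Let $a$ and $b$ be odd positive integers and let $c$ be an even positive integer. Then for all nonnegative integers $m$ and $n$ with $(m,n)\ne(0,0)$, \[ \sum_{\substack{n_0+n_1+\dots+n_{2m}=n\\ n_0,\ldots,n_{2m}\ge 0}} \zeta_{\mathcal{A}}\bigl(\{c\}^{n_0},a,\{c\}^{n_1},b,\{c\}^{n_2},\ldots,a,\{c\}^{n_{2m-1}},b,\{c\}^{n_{2m}}\bigr) =\sum_{\substack{n_0+n_1+\dots+n_{2m}=n\\ n_0,\ldots,n_{2m}\ge 0}} \zeta^{\star}_{\mathcal{A}}\bigl(\{c\}^{n_0},a,\{c\}^{n_1},b,\{c\}^{n_2},\ldots,a,\{c\}^{n_{2m-1}},b,\{c\}^{n_{2m}}\bigr) =0 . \] (Here the argument sequence consists of $m$ copies of the pattern $a,\{c\}^{\ast},b,\{c\}^{\ast}$ preceded by $\{c\}^{n_0}$; when $m=0$ the sum is just $\zeta_{\mathcal{A}}(\{c\}^n)$, resp. $\zeta^\star_{\mathcal{A}}(\{c\}^n)$.)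
   Context: Let $\mathcal{A}=\bigl(\prod_{p}\mathbb{Z}/p\mathbb{Z}\bigr)/\bigl(\bigoplus_{p}\mathbb{Z}/p\mathbb{Z}\bigr)$, where $p$ runs over all primes; its elements are families $(a_p)_p$ with $a_p\in\mathbb{Z}/p\mathbb{Z}$, two families being identified if they agree for all but finitely many $p$. It is a $\mathbb{Q}$-algebra. For positive integers $k_1,\dots,k_n$, define $\zeta_{\mathcal{A}}(k_1,\dots,k_n)=\bigl(\sum_{p>m_1>\dots>m_n\ge1} m_1^{-k_1}\cdots m_n^{-k_n} \bmod p\bigr)_p\in\mathcal{A}$ and $\zeta^{\star}_{\mathcal{A}}(k_1,\dots,k_n)=\bigl(\sum_{p>m_1\ge\dots\ge m_n\ge1} m_1^{-k_1}\cdots m_n^{-k_n} \bmod p\bigr)_p\in\mathcal{A}$. The notation $\{c\}^{k}$ denotes the sequence $c,c,\dots,c$ of length $k$ (empty if $k=0$). *)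

theory Defs
  imports "HOL-Number_Theory.Number_Theory"
begin

text \<open>
  The ring \<open>\<A> = (\<Prod>\<^sub>p \<int>/p\<int>) / (\<Oplus>\<^sub>p \<int>/p\<int>)\<close>. A family \<open>(a\<^sub>p)\<^sub>p\<close> is represented by a function
  \<open>f\<close> whose value \<open>f p\<close> at a prime \<open>p\<close> is any integer in the residue class \<open>a\<^sub>p\<close>; values at
  non-primes are irrelevant. Passing to \<open>\<int>/p\<int>\<close> in each component and then dividing by the direct
  sum is one quotient: congruence modulo \<open>p\<close> for all but finitely many primes \<open>p\<close>.
\<close>

definition almost_cong :: "(nat \<Rightarrow> int) \<Rightarrow> (nat \<Rightarrow> int) \<Rightarrow> bool" where
  "almost_cong f g \<longleftrightarrow> (\<forall>\<^sub>F p in cofinite. prime p \<longrightarrow> [f p = g p] (mod int p))"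

lemma almost_cong_iff_finite:
  "almost_cong f g \<longleftrightarrow> finite {p. prime p \<and> \<not> [f p = g p] (mod int p)}"
  by (simp add: almost_cong_def eventually_cofinite)

lemma equivp_almost_cong: "equivp almost_cong"
proof (rule equivpI)
  show "reflp almost_cong"
    by (simp add: reflp_def almost_cong_def)
  show "symp almost_cong"
    by (auto simp: symp_def almost_cong_def cong_sym_eq)
  show "transp almost_cong"
    unfolding transp_def almost_cong_def
    by (auto elim: eventually_elim2 intro: cong_trans)
qed

quotient_type ring_A = "nat \<Rightarrow> int" / almost_cong
  by (rule equivp_almost_cong)

instantiation ring_A :: comm_ring_1
begin

lift_definition zero_ring_A :: ring_A is "\<lambda>_. 0" .

lift_definition one_ring_A :: ring_A is "\<lambda>_. 1" .

lift_definition plus_ring_A :: "ring_A \<Rightarrow> ring_A \<Rightarrow> ring_A" is "\<lambda>f g p. f p + g p"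
  unfolding almost_cong_def by (auto elim: eventually_elim2 intro: cong_add)

lift_definition minus_ring_A :: "ring_A \<Rightarrow> ring_A \<Rightarrow> ring_A" is "\<lambda>f g p. f p - g p"
  unfolding almost_cong_def by (auto elim: eventually_elim2 intro: cong_diff)

lift_definition uminus_ring_A :: "ring_A \<Rightarrow> ring_A" is "\<lambda>f p. - f p"
  unfolding almost_cong_def by (auto elim: eventually_mono simp: cong_minus_minus_iff)

lift_definition times_ring_A :: "ring_A \<Rightarrow> ring_A \<Rightarrow> ring_A" is "\<lambda>f g p. f p * g p"
  unfolding almost_cong_def by (auto elim: eventually_elim2 intro: cong_mult)

instance
proof
  have "infinite {p::nat. prime p \<and> \<not> [0 = 1] (mod int p)}"
  proof -
    have "{p::nat. prime p \<and> \<not> [0 = 1] (mod int p)} = {p. prime p}"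
      by (auto simp: cong_iff_dvd_diff dest: prime_gt_1_nat)
    thus ?thesis using primes_infinite by simp
  qed
  thus "(0::ring_A) \<noteq> 1"
    by transfer (simp add: almost_cong_iff_finite)
qed (transfer; simp add: almost_cong_def algebra_simps)+

end

text \<open>
  Truncated sums over \<open>p > m\<^sub>1 > \<dots> > m\<^sub>r \<ge> 1\<close>, resp. \<open>p > m\<^sub>1 \<ge> \<dots> \<ge> m\<^sub>r \<ge> 1\<close>, as integer
  representatives of classes modulo \<open>p\<close>. List positions are counted from 0.
\<close>

definition zeta_trunc :: "nat \<Rightarrow> nat list \<Rightarrow> int" where
  "zeta_trunc p ks =
     (\<Sum>ms | length ms = length ks \<and> set ms \<subseteq> {1..<p} \<and> sorted_wrt (>) ms.
        \<Prod>i<length ks. modular_inverse (int p) (int (ms ! i)) ^ (ks ! i))"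

definition zeta_star_trunc :: "nat \<Rightarrow> nat list \<Rightarrow> int" where
  "zeta_star_trunc p ks =
     (\<Sum>ms | length ms = length ks \<and> set ms \<subseteq> {1..<p} \<and> sorted_wrt (\<ge>) ms.
        \<Prod>i<length ks. modular_inverse (int p) (int (ms ! i)) ^ (ks ! i))"

lift_definition zeta_A :: "nat list \<Rightarrow> ring_A" is "\<lambda>ks p. zeta_trunc p ks" .

lift_definition zeta_star_A :: "nat list \<Rightarrow> ring_A" is "\<lambda>ks p. zeta_star_trunc p ks" .

text \<open>
  For \<open>ns = [n\<^sub>0, \<dots>, n\<^sub>2\<^sub>m]\<close> this is
  \<open>{c}\<^bsup>n\<^sub>0\<^esup>, a, {c}\<^bsup>n\<^sub>1\<^esup>, b, {c}\<^bsup>n\<^sub>2\<^esup>, \<dots>, a, {c}\<^bsup>n\<^sub>2\<^sub>m\<^sub>-\<^sub>1\<^esup>, b, {c}\<^bsup>n\<^sub>2\<^sub>m\<^esup>\<close>.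
\<close>

definition interleaved_args :: "nat \<Rightarrow> nat \<Rightarrow> nat \<Rightarrow> nat \<Rightarrow> nat list \<Rightarrow> nat list" where
  "interleaved_args a b c m ns =
     replicate (ns ! 0) c @
     concat (map (\<lambda>j. a # replicate (ns ! (2 * j + 1)) c @ b # replicate (ns ! (2 * j + 2)) c)
       [0..<m])"

definition weak_compositions :: "nat \<Rightarrow> nat \<Rightarrow> nat list set" where
  "weak_compositions r n = {ns. length ns = r \<and> sum_list ns = n}"

lemma finite_weak_compositions: "finite (weak_compositions r n)"
proof (rule finite_subset)
  show "weak_compositions r n \<subseteq> {ns. set ns \<subseteq> {..n} \<and> length ns = r}"
    by (auto simp: weak_compositions_def member_le_sum_list)
  show "finite {ns. set ns \<subseteq> {..n} \<and> length ns = r}"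
    by (rule finite_lists_length_eq) simp
qed

end

(* Both sums are entries of a product over k = 1, ..., p - 1 of 2x2 transfer matrices in w = 1/k,
   acting on the generating functions (x marks a letter c, t marks a pair a, b) of the words whose
   next letter other than c is a, respectively b.  Since a, b are odd and c is even, the matrices
   I + N(w) = (1 + x w^c, t w^a; w^b, 1 + x w^c) and I + N(-w) multiply to the scalar
   (1 + x w^c)^2 - t w^(a+b), so the product over w, -w in antisymmetric order is the scalar
   H = prod_{k <= (p-1)/2} ((1 + x k^-c)^2 - t k^-(a+b)).  In the star case the matrices are the
   inverses of I - N(w), and the same argument gives the inverse of H with x replaced by -x.
   Doubling permutes the k <= (p-1)/2 modulo p up to sign, so the coefficient of x^n t^m in H is
   invariant under multiplication by 2^(nc + m(a+b)); it vanishes modulo every p exceeding that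
   number. *)

theory Submission
  imports Defs "HOL-Computational_Algebra.Formal_Power_Series"
begin

section \<open>Truncated multiple sums\<close>

text \<open>\<open>e = 1\<close> gives strictly and \<open>e = 0\<close> weakly decreasing tuples,
  so that one recursion serves both kinds of sums.\<close>

definition chains :: "nat \<Rightarrow> nat \<Rightarrow> nat \<Rightarrow> nat list set" where
  "chains e k r = {ms. length ms = r \<and> set ms \<subseteq> {1..k} \<and> sorted_wrt (\<lambda>x y. y + e \<le> x) ms}"

text \<open>The weights \<open>u\<close> stay arbitrary because the inverses modulo a prime are
  later exchanged for congruent integers that are exactly antisymmetric.\<close>

definition trunc_sum :: "nat \<Rightarrow> (nat \<Rightarrow> int) \<Rightarrow> nat \<Rightarrow> nat list \<Rightarrow> int" where
  "trunc_sum e u k ks = (\<Sum>ms \<in> chains e k (length ks). \<Prod>i<length ks. u (ms ! i) ^ (ks ! i))"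

lemma finite_chains: "finite (chains e k r)"
  by (rule finite_subset[OF _ finite_lists_length_eq[of "{1..k}" r]]) (auto simp: chains_def)

lemma chains_0: "chains e k 0 = {[]}"
  by (auto simp: chains_def)

lemma chains_Suc_Suc:
  assumes "e \<le> 1"
  shows "chains e (Suc k) (Suc r) = chains e k (Suc r) \<union> (#) (Suc k) ` chains e (Suc k - e) r"
proof (intro equalityI subsetI)
  fix ms assume "ms \<in> chains e (Suc k) (Suc r)"
  then obtain x xs where ms: "ms = x # xs" and *: "length xs = r" "x \<in> {1..Suc k}"
      "set xs \<subseteq> {1..Suc k}" "\<forall>y\<in>set xs. y + e \<le> x" "sorted_wrt (\<lambda>x y. y + e \<le> x) xs"
    by (cases ms) (auto simp: chains_def)
  show "ms \<in> chains e k (Suc r) \<union> (#) (Suc k) ` chains e (Suc k - e) r"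
  proof (cases "x = Suc k")
    case True
    then have "xs \<in> chains e (Suc k - e) r"
      using * by (fastforce simp: chains_def)
    then show ?thesis using ms True by simp
  next
    case False
    then have "ms \<in> chains e k (Suc r)"
      using * ms by (fastforce simp: chains_def)
    then show ?thesis by simp
  qed
next
  fix ms assume "ms \<in> chains e k (Suc r) \<union> (#) (Suc k) ` chains e (Suc k - e) r"
  then show "ms \<in> chains e (Suc k) (Suc r)"
    using assms by (fastforce simp: chains_def)
qed

lemma trunc_sum_Nil [simp]: "trunc_sum e u k [] = 1"
  by (simp add: trunc_sum_def chains_0)

lemma trunc_sum_0_Cons [simp]: "trunc_sum e u 0 (l # ls) = 0"
proof -
  have "chains e 0 (Suc r) = {}" for r
    by (auto simp: chains_def length_Suc_conv)
  then show ?thesis by (simp add: trunc_sum_def)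
qed

text \<open>The largest index is either at most \<open>k\<close> or equal to \<open>Suc k\<close>.
  For \<open>e = 0\<close> the remaining word keeps the bound \<open>Suc k\<close>, which makes the
  later recursions implicit.\<close>

lemma trunc_sum_Suc_Cons:
  assumes "e \<le> 1"
  shows "trunc_sum e u (Suc k) (l # ls) =
           trunc_sum e u k (l # ls) + u (Suc k) ^ l * trunc_sum e u (Suc k - e) ls"
proof -
  have "chains e k (Suc r) \<inter> (#) (Suc k) ` A = {}" for r A
    by (auto simp: chains_def)
  then show ?thesis
    by (simp add: trunc_sum_def chains_Suc_Suc[OF assms] sum.union_disjoint finite_chains
        sum.reindex prod.lessThan_Suc_shift sum_distrib_left comp_def del: prod.lessThan_Suc)
qed

lemma trunc_sum_cong_mod:
  assumes "\<And>i. i \<in> {1..k} \<Longrightarrow> [u i = v i] (mod q)"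
  shows "[trunc_sum e u k ks = trunc_sum e v k ks] (mod q)"
  unfolding trunc_sum_def
proof (intro cong_sum cong_prod cong_pow assms)
  fix ms i assume "ms \<in> chains e k (length ks)" "i \<in> {..<length ks}"
  then show "ms ! i \<in> {1..k}"
    by (auto simp: chains_def subset_iff)
qed

lemma zeta_trunc_eq_trunc_sum:
  assumes "p > 0"
  shows "zeta_trunc p = trunc_sum 1 (\<lambda>i. modular_inverse (int p) (int i)) (p - 1)"
proof -
  have "{1..<p} = {1..p - 1}" using assms by auto
  moreover have "(\<lambda>x y::nat. y + 1 \<le> x) = (>)" by (auto simp: fun_eq_iff)
  ultimately show ?thesis
    by (simp add: fun_eq_iff zeta_trunc_def trunc_sum_def chains_def)
qed

lemma zeta_star_trunc_eq_trunc_sum: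
  assumes "p > 0"
  shows "zeta_star_trunc p = trunc_sum 0 (\<lambda>i. modular_inverse (int p) (int i)) (p - 1)"
proof -
  have "{1..<p} = {1..p - 1}" using assms by auto
  then show ?thesis
    by (simp add: fun_eq_iff zeta_star_trunc_def trunc_sum_def chains_def)
qed

section \<open>Sums over interleaved words\<close>

text \<open>Produces the word letter by letter; the parity of the number of blocks still to come
  decides between \<open>a\<close> and \<open>b\<close>. Nonempty lists of even length give the
  words whose first letter other than \<open>c\<close> is \<open>b\<close>.\<close>

function interleave :: "nat \<Rightarrow> nat \<Rightarrow> nat \<Rightarrow> nat list \<Rightarrow> nat list" where
  "interleave a b c [] = []"
| "interleave a b c (Suc i # ns) = c # interleave a b c (i # ns)"
| "interleave a b c (0 # ns) =
     (if ns = [] then [] else (if even (length ns) then a else b) # interleave a b c ns)"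
  by pat_completeness auto
termination by (relation "measure (\<lambda>(a, b, c, ns). sum_list ns + length ns)") auto

lemma interleave_Cons:
  "interleave a b c (i # ns) = replicate i c @ interleave a b c (0 # ns)"
  by (induction i) auto

lemma interleaved_args_eq_interleave:
  "length ns = 2 * m + 1 \<Longrightarrow> interleaved_args a b c m ns = interleave a b c ns"
proof (induction m arbitrary: ns)
  case 0
  then obtain i where "ns = [i]" by (auto simp: length_Suc_conv)
  then show ?case by (simp add: interleaved_args_def interleave_Cons[of _ _ _ i])
next
  case (Suc m)
  then obtain i j ns' where ns: "ns = i # j # ns'" "length ns' = 2 * m + 1"
    by (auto simp: length_Suc_conv)
  then obtain k ns'' where ns': "ns' = k # ns''" by (cases ns') auto
  have "interleaved_args a b c (Suc m) ns =
      replicate i c @ a # replicate j c @ b # interleaved_args a b c m ns'"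
    by (simp add: interleaved_args_def ns ns' upt_conv_Cons map_Suc_upt[symmetric] comp_def
        del: upt_Suc)
  also have "\<dots> = interleave a b c ns"
    using ns(2) Suc.IH[OF ns(2)]
    by (simp add: ns(1) interleave_Cons[of _ _ _ i] interleave_Cons[of _ _ _ j] ns')
  finally show ?case .
qed

text \<open>A positive first part is lowered by 1, a zero first part is dropped. For words this is
  the choice between another \<open>c\<close> and the end of the block.\<close>

lemma sum_weak_compositions_Suc:
  "(\<Sum>ns \<in> weak_compositions (Suc r) n. g ns) =
     (if n = 0 then 0 else \<Sum>ns \<in> weak_compositions (Suc r) (n - 1). g (Suc (hd ns) # tl ns)) +
     (\<Sum>ns \<in> weak_compositions r n. g (0 # ns) :: 'a :: comm_monoid_add)"
proof -
  let ?f = "\<lambda>ns. Suc (hd ns) # tl ns"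
  \<comment> \<open>For \<open>n = 0\<close> the term \<open>n - 1\<close> would be 0 and give lists
    of sum 1.\<close>
  let ?A = "if n = 0 then {} else ?f ` weak_compositions (Suc r) (n - 1)"
  have "weak_compositions (Suc r) n = ?A \<union> (#) 0 ` weak_compositions r n"
  proof (intro equalityI subsetI)
    fix ns assume ns: "ns \<in> weak_compositions (Suc r) n"
    then obtain i ns' where ns': "ns = i # ns'" by (cases ns) (auto simp: weak_compositions_def)
    show "ns \<in> ?A \<union> (#) 0 ` weak_compositions r n"
    proof (cases i)
      case 0
      then show ?thesis using ns ns' by (auto simp: weak_compositions_def)
    next
      case (Suc i')
      then have "i' # ns' \<in> weak_compositions (Suc r) (n - 1)" "n \<noteq> 0"
        using ns ns' by (auto simp: weak_compositions_def)
      moreover from this(1) have "ns \<in> ?f ` weak_compositions (Suc r) (n - 1)"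
        using ns' Suc by (intro image_eqI[of ns ?f "i' # ns'"]) simp_all
      ultimately have "ns \<in> ?A"
        by (simp only: if_False)
      then show ?thesis ..
    qed
  next
    fix ns assume "ns \<in> ?A \<union> (#) 0 ` weak_compositions r n"
    then show "ns \<in> weak_compositions (Suc r) n"
      by (auto simp: weak_compositions_def length_Suc_conv split: if_splits)
  qed
  moreover have "?A \<inter> (#) 0 ` weak_compositions r n = {}"
    by auto
  moreover have "finite ?A"
    by (simp add: finite_weak_compositions)
  ultimately have "(\<Sum>ns \<in> weak_compositions (Suc r) n. g ns) =
      sum g ?A + (\<Sum>ns \<in> weak_compositions r n. g (0 # ns))"
    by (simp only: sum.union_disjoint finite_weak_compositions finite_imageI)
      (simp add: sum.reindex comp_def)
  moreover have "inj_on ?f (weak_compositions (Suc r) (n - 1))"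
  proof (rule inj_onI)
    fix x y assume "x \<in> weak_compositions (Suc r) (n - 1)" "y \<in> weak_compositions (Suc r) (n - 1)"
      "?f x = ?f y"
    then show "x = y"
      by (cases x; cases y) (simp_all add: weak_compositions_def)
  qed
  ultimately show ?thesis
    by (cases "n = 0") (simp_all only: if_True if_False sum.empty sum.reindex comp_def refl)
qed

text \<open>Words are sorted by first letter: none, \<open>c\<close>, or the letter prescribed by
  the parity of \<open>j\<close>. The form \<open>Suc (j - 1)\<close> shows the last sum as the same
  kind of sum at \<open>j - 1\<close>.\<close>

lemma sum_interleave_rec:
  "(\<Sum>ns \<in> weak_compositions (Suc j) n. g (interleave a b c ns)) =
     (if n = 0 \<and> j = 0 then g [] else 0) +
     (if n = 0 then 0
      else \<Sum>ns \<in> weak_compositions (Suc j) (n - 1). g (c # interleave a b c ns)) +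
     (if j = 0 then 0
      else \<Sum>ns \<in> weak_compositions (Suc (j - 1)) n.
             g ((if even j then a else b) # interleave a b c ns) :: int)"
proof -
  have "(\<Sum>ns \<in> weak_compositions (Suc j) (n - 1). g (interleave a b c (Suc (hd ns) # tl ns))) =
      (\<Sum>ns \<in> weak_compositions (Suc j) (n - 1). g (c # interleave a b c ns))"
    by (intro sum.cong) (auto simp: weak_compositions_def length_Suc_conv)
  moreover have "(\<Sum>ns \<in> weak_compositions j n. g (interleave a b c (0 # ns))) =
      (if n = 0 \<and> j = 0 then g [] else 0) +
      (if j = 0 then 0 else \<Sum>ns \<in> weak_compositions (Suc (j - 1)) n.
             g ((if even j then a else b) # interleave a b c ns))"
  proof (cases "j = 0")
    case True
    have "weak_compositions 0 n = (if n = 0 then {[]} else {})"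
      by (auto simp: weak_compositions_def)
    then show ?thesis using True by simp
  next
    case False
    then show ?thesis
      by (auto intro!: sum.cong simp: weak_compositions_def)
  qed
  ultimately show ?thesis
    by (subst sum_weak_compositions_Suc) simp
qed

section \<open>Recursion of the word sums in the summation bound\<close>

definition word_sum ::
    "nat \<Rightarrow> nat \<Rightarrow> nat \<Rightarrow> nat \<Rightarrow> (nat \<Rightarrow> int) \<Rightarrow> nat \<Rightarrow> nat \<Rightarrow> nat \<Rightarrow> int" where
  "word_sum a b c e u k j n =
     (\<Sum>ns \<in> weak_compositions (Suc j) n. trunc_sum e u k (interleave a b c ns))"

lemma word_sum_0: "word_sum a b c e u 0 j n = (if j = 0 \<and> n = 0 then 1 else 0)"
  unfolding word_sum_def by (subst sum_interleave_rec) simp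

lemma word_sum_0_0: "word_sum a b c e u k 0 0 = 1"
  unfolding word_sum_def by (subst sum_interleave_rec) simp

text \<open>Here \<open>j\<close> counts the letters \<open>a\<close> and \<open>b\<close>, and
  \<open>n\<close> the letters \<open>c\<close>. Expanding by first letter at both bounds leaves as
  difference the terms with largest index \<open>Suc k\<close>.\<close>

lemma word_sum_Suc:
  assumes "e \<le> 1"
  shows "word_sum a b c e u (Suc k) j n = word_sum a b c e u k j n +
           (if n = 0 then 0 else u (Suc k) ^ c * word_sum a b c e u (Suc k - e) j (n - 1)) +
           (if j = 0 then 0 else u (Suc k) ^ (if even j then a else b) *
              word_sum a b c e u (Suc k - e) (j - 1) n)"
  unfolding word_sum_def sum_interleave_rec[of "trunc_sum e u (Suc k)"]
    sum_interleave_rec[of "trunc_sum e u k" a b c j n]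
  by (simp add: trunc_sum_Suc_Cons[OF assms] sum.distrib sum_distrib_left)

section \<open>Generating functions\<close>

text \<open>The outer variable \<open>X_ab\<close> marks pairs \<open>a\<close>, \<open>b\<close>
  and has degree \<open>i\<close>; the inner variable \<open>X_c\<close> marks letters
  \<open>c\<close> and has degree \<open>j\<close>.\<close>

abbreviation coeff2 :: "int fps fps \<Rightarrow> nat \<Rightarrow> nat \<Rightarrow> int" where
  "coeff2 F i j \<equiv> fps_nth (fps_nth F i) j"

abbreviation X_c :: "int fps fps" where "X_c \<equiv> fps_const fps_X"

abbreviation X_ab :: "int fps fps" where "X_ab \<equiv> fps_X"

lemma fps2_eqI: "(\<And>i j. coeff2 F i j = coeff2 G i j) \<Longrightarrow> F = G"
  by (intro fps_ext) auto

lemma coeff2_of_int_mult [simp]: "coeff2 (of_int q * F) i j = q * coeff2 F i j"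
  by simp

lemma coeff2_mult:
  "coeff2 (F * G) i j = (\<Sum>k\<le>i. \<Sum>l\<le>j. coeff2 F k l * coeff2 G (i - k) (j - l))"
  by (simp add: fps_mult_nth fps_sum_nth atLeast0AtMost)

definition even_gf ::
    "nat \<Rightarrow> nat \<Rightarrow> nat \<Rightarrow> nat \<Rightarrow> (nat \<Rightarrow> int) \<Rightarrow> nat \<Rightarrow> int fps fps" where
  "even_gf a b c e u k = Abs_fps (\<lambda>i. Abs_fps (word_sum a b c e u k (2 * i)))"

definition odd_gf ::
    "nat \<Rightarrow> nat \<Rightarrow> nat \<Rightarrow> nat \<Rightarrow> (nat \<Rightarrow> int) \<Rightarrow> nat \<Rightarrow> int fps fps" where
  "odd_gf a b c e u k = Abs_fps (\<lambda>i. Abs_fps (word_sum a b c e u k (2 * i + 1)))"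

lemma even_gf_0: "even_gf a b c e u 0 = 1"
  by (rule fps2_eqI) (auto simp: even_gf_def word_sum_0)

lemma even_gf_Suc:
  assumes "e \<le> 1"
  shows "even_gf a b c e u (Suc k) = even_gf a b c e u k +
           of_int (u (Suc k) ^ c) * (X_c * even_gf a b c e u (Suc k - e)) +
           of_int (u (Suc k) ^ a) * (X_ab * odd_gf a b c e u (Suc k - e))"
proof -
  \<comment> \<open>Prefixing \<open>a\<close> to an odd word completes a pair: \<open>2 * i\<close>
    comes from \<open>2 * (i - 1) + 1\<close>, hence the factor \<open>X_ab\<close>.\<close>
  have "2 * i - Suc 0 = Suc (2 * (i - Suc 0))" if "i > 0" for i
    using that by simp
  then show ?thesis
    by (intro fps2_eqI)
      (auto simp: even_gf_def odd_gf_def word_sum_Suc[OF assms] simp del: of_int_power)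
qed

lemma odd_gf_Suc:
  assumes "e \<le> 1"
  shows "odd_gf a b c e u (Suc k) = odd_gf a b c e u k +
           of_int (u (Suc k) ^ c) * (X_c * odd_gf a b c e u (Suc k - e)) +
           of_int (u (Suc k) ^ b) * even_gf a b c e u (Suc k - e)"
  by (intro fps2_eqI)
    (auto simp: even_gf_def odd_gf_def word_sum_Suc[OF assms] simp del: of_int_power)

text \<open>The transfer matrices at \<open>k\<close> and \<open>2 * h + 1 - k\<close> multiply to a scalar, so the product
  collapses from the middle outwards.\<close>

lemma antisymmetric_transfer:
  fixes E O' \<alpha> \<beta> \<gamma> :: "nat \<Rightarrow> 'a :: comm_ring_1"
  assumes E: "\<And>k. k < 2 * h \<Longrightarrow> E (Suc k) = \<alpha> (Suc k) * E k + \<beta> (Suc k) * O' k"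
    and O': "\<And>k. k < 2 * h \<Longrightarrow> O' (Suc k) = \<alpha> (Suc k) * O' k + \<gamma> (Suc k) * E k"
    and sym: "\<And>k. k \<in> {1..h} \<Longrightarrow> \<alpha> (2 * h + 1 - k) = \<alpha> k"
      "\<And>k. k \<in> {1..h} \<Longrightarrow> \<beta> (2 * h + 1 - k) = - \<beta> k"
      "\<And>k. k \<in> {1..h} \<Longrightarrow> \<gamma> (2 * h + 1 - k) = - \<gamma> k"
  shows "E (2 * h) = (\<Prod>k=1..h. \<alpha> k ^ 2 - \<beta> k * \<gamma> k) * E 0"
proof -
  let ?P = "\<lambda>i. \<Prod>k=Suc (h - i)..h. \<alpha> k ^ 2 - \<beta> k * \<gamma> k"
  \<comment> \<open>The \<open>i\<close> index pairs around the middle have collapsed to one scalar,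
    the same for both components.\<close>
  have "i \<le> h \<Longrightarrow> E (h + i) = ?P i * E (h - i) \<and> O' (h + i) = ?P i * O' (h - i)" for i
  proof (induction i)
    case 0
    then show ?case by simp
  next
    case (Suc i)
    define k where "k = h - Suc i"
    have k: "h - i = Suc k" "Suc k \<in> {1..h}" "h + i < 2 * h" "k < 2 * h"
        "2 * h + 1 - Suc k = Suc (h + i)"
      using Suc.prems by (auto simp: k_def)
    have IH: "E (h + i) = ?P i * E (Suc k)" "O' (h + i) = ?P i * O' (Suc k)"
      using Suc k(1) by auto
    define Q where "Q = ?P i"
    have P: "?P (Suc i) = (\<alpha> (Suc k) ^ 2 - \<beta> (Suc k) * \<gamma> (Suc k)) * Q"
      using k by (simp add: Q_def k_def[symmetric] prod.atLeast_Suc_atMost)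
    \<comment> \<open>With entries taken at \<open>Suc k\<close>, the two new matrices are
      (\<alpha>, \<beta>; \<gamma>, \<alpha>) and (\<alpha>, -\<beta>; -\<gamma>, \<alpha>); the
      mixed terms of their product cancel.\<close>
    show ?case
      using E[OF k(3)] O'[OF k(3)] E[OF k(4)] O'[OF k(4)] sym[OF k(2)]
      unfolding P IH[folded Q_def] k(5)
      by (simp add: k_def[symmetric] power2_eq_square algebra_simps)
  qed
  from this[of h] show ?thesis by (simp add: mult_2)
qed

section \<open>Closed forms at the bound \<open>2 * h\<close>\<close>

lemma even_gf_nonstar:
  assumes "odd a" "odd b" "even c"
    and anti: "\<And>k. k \<in> {1..h} \<Longrightarrow> u (2 * h + 1 - k) = - u k"
  shows "even_gf a b c 1 u (2 * h) =
           (\<Prod>k=1..h. (1 + of_int (u k ^ c) * X_c) ^ 2 - of_int (u k ^ (a + b)) * X_ab)"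
proof -
  \<comment> \<open>The diagonal entry is even in \<open>u k\<close>, since \<open>c\<close> is
    even; the other two are odd, since \<open>a\<close> and \<open>b\<close> are. Hence
    \<open>anti\<close> yields the required symmetry.\<close>
  have "even_gf a b c 1 u (2 * h) =
      (\<Prod>k=1..h. (1 + of_int (u k ^ c) * X_c) ^ 2 -
         (of_int (u k ^ a) * X_ab) * of_int (u k ^ b)) * even_gf a b c 1 u 0"
    by (rule antisymmetric_transfer[where O' = "odd_gf a b c 1 u"])
      (use assms in \<open>simp_all add: even_gf_Suc odd_gf_Suc algebra_simps\<close>)
  then show ?thesis
    by (simp add: even_gf_0 power_add mult_ac)
qed

text \<open>For \<open>e = 0\<close> the new values stand on the right of the recursion, so it is
  solved for the old ones and run from \<open>2 * h\<close> down to 0, where the value is 1.\<close>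

lemma even_gf_star:
  assumes "odd a" "odd b" "even c"
    and anti: "\<And>k. k \<in> {1..h} \<Longrightarrow> u (2 * h + 1 - k) = - u k"
  shows "(\<Prod>k=1..h. (1 - of_int (u k ^ c) * X_c) ^ 2 - of_int (u k ^ (a + b)) * X_ab) *
           even_gf a b c 0 u (2 * h) = 1"
proof -
  \<comment> \<open>The reversed run uses the antisymmetry at every index up to
    \<open>2 * h\<close>.\<close>
  have anti': "u (2 * h + 1 - k) = - u k" if "k \<in> {1..2 * h}" for k
  proof (cases "k \<le> h")
    case False
    then have "2 * h + 1 - k \<in> {1..h}" "2 * h + 1 - (2 * h + 1 - k) = k"
      using that by auto
    then show ?thesis using anti[of "2 * h + 1 - k"] by simp
  qed (use anti that in simp)
  let ?E = "\<lambda>k. even_gf a b c 0 u (2 * h - k)"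
  let ?O = "\<lambda>k. odd_gf a b c 0 u (2 * h - k)"
  have "?E (2 * h) =
      (\<Prod>k=1..h. (1 - of_int (u k ^ c) * X_c) ^ 2 -
         (of_int (u k ^ a) * X_ab) * of_int (u k ^ b)) * ?E 0"
  proof (rule antisymmetric_transfer[where O' = ?O])
    fix k assume "k < 2 * h"
    then have k: "Suc (2 * h - Suc k) = 2 * h - k"
      by simp
    \<comment> \<open>At odd exponents this sign cancels the minus sign that comes from solving for
      the old values.\<close>
    have u: "u (2 * h - k) = - u (Suc k)"
      using anti'[of "Suc k"] \<open>k < 2 * h\<close> by simp
    show "?E (Suc k) = (1 - of_int (u (Suc k) ^ c) * X_c) * ?E k +
        of_int (u (Suc k) ^ a) * X_ab * ?O k"
      using even_gf_Suc[of 0 a b c u "2 * h - Suc k"] assms unfolding k u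
      by (simp add: algebra_simps)
    show "?O (Suc k) = (1 - of_int (u (Suc k) ^ c) * X_c) * ?O k + of_int (u (Suc k) ^ b) * ?E k"
      using odd_gf_Suc[of 0 a b c u "2 * h - Suc k"] assms unfolding k u
      by (simp add: algebra_simps)
  qed (use assms in simp_all)
  then show ?thesis
    by (simp add: even_gf_0 power_add mult_ac)
qed

section \<open>Vanishing modulo large primes\<close>

text \<open>Coefficientwise form of the congruence of F(t, x) with G(r^d t, r^e x), where t is the
  outer and x the inner variable.\<close>

definition scaled_cong :: "int \<Rightarrow> int \<Rightarrow> nat \<Rightarrow> nat \<Rightarrow> int fps fps \<Rightarrow> int fps fps \<Rightarrow> bool" where
  "scaled_cong q r d e F G \<longleftrightarrow>
     (\<forall>i j. [coeff2 F i j = r ^ (d * i + e * j) * coeff2 G i j] (mod q))"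

lemma scaled_cong_mult:
  assumes "scaled_cong q r d e F G" "scaled_cong q r d e F' G'"
  shows "scaled_cong q r d e (F * F') (G * G')"
  unfolding scaled_cong_def coeff2_mult sum_distrib_left
proof (intro allI cong_sum)
  fix i j k l :: nat assume "k \<in> {..i}" "l \<in> {..j}"
  then have "i = k + (i - k)" "j = l + (j - l)"
    by auto
  \<comment> \<open>The weight is additive in the degrees, so every term of the convolution carries
    the same power of \<open>r\<close>.\<close>
  then have "d * i + e * j = (d * k + e * l) + (d * (i - k) + e * (j - l))"
    by (metis add.commute add.left_commute distrib_left)
  then have "r ^ (d * i + e * j) * (coeff2 G k l * coeff2 G' (i - k) (j - l)) =
      (r ^ (d * k + e * l) * coeff2 G k l) *
      (r ^ (d * (i - k) + e * (j - l)) * coeff2 G' (i - k) (j - l))"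
    by (simp only: power_add mult_ac)
  moreover have "[coeff2 F k l * coeff2 F' (i - k) (j - l) =
      (r ^ (d * k + e * l) * coeff2 G k l) *
      (r ^ (d * (i - k) + e * (j - l)) * coeff2 G' (i - k) (j - l))] (mod q)"
    using assms by (intro cong_mult) (simp_all add: scaled_cong_def)
  ultimately show "[coeff2 F k l * coeff2 F' (i - k) (j - l) =
      r ^ (d * i + e * j) * (coeff2 G k l * coeff2 G' (i - k) (j - l))] (mod q)"
    by (simp only:)
qed

lemma scaled_cong_prod:
  "(\<And>k. k \<in> A \<Longrightarrow> scaled_cong q r d e (F k) (G k)) \<Longrightarrow>
     scaled_cong q r d e (prod F A) (prod G A)"
proof (induction A rule: infinite_finite_induct)
  case (insert k A)
  then show ?case by (simp add: scaled_cong_mult)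
qed (auto simp: scaled_cong_def)

lemma scaled_cong_diff:
  "scaled_cong q r d e F G \<Longrightarrow> scaled_cong q r d e F' G' \<Longrightarrow>
     scaled_cong q r d e (F - F') (G - G')"
  by (auto simp: scaled_cong_def right_diff_distrib intro: cong_diff)

text \<open>Since \<open>s ^ d\<close> accompanies the outer and \<open>s ^ e\<close> the inner
  variable, replacing \<open>s\<close> by \<open>r * s'\<close> rescales the variables. Later
  \<open>\<sigma>\<close> is 1 for ordinary and -1 for star sums.\<close>

lemma scaled_cong_factor:
  assumes "[s = r * s'] (mod q)"
  shows "scaled_cong q r d e
           ((1 + of_int (\<sigma> * s ^ e) * X_c) ^ 2 - of_int (s ^ d) * X_ab)
           ((1 + of_int (\<sigma> * s' ^ e) * X_c) ^ 2 - of_int (s' ^ d) * X_ab)"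
proof -
  have pow: "[s ^ k = r ^ k * s' ^ k] (mod q)" for k
    using cong_pow[OF assms, of k] by (simp add: power_mult_distrib)
  have lin: "scaled_cong q r d e (1 + of_int (\<sigma> * s ^ e) * X_c) (1 + of_int (\<sigma> * s' ^ e) * X_c)"
    unfolding scaled_cong_def
  proof (intro allI)
    fix i j
    show "[coeff2 (1 + of_int (\<sigma> * s ^ e) * X_c) i j =
        r ^ (d * i + e * j) * coeff2 (1 + of_int (\<sigma> * s' ^ e) * X_c) i j] (mod q)"
      using cong_scalar_left[OF pow[of e], of \<sigma>]
      by (auto simp: fps_X_nth mult_ac simp del: of_int_mult of_int_power)
  qed
  have "scaled_cong q r d e (of_int (s ^ d) * X_ab) (of_int (s' ^ d) * X_ab)"
    using pow[of d] by (auto simp: scaled_cong_def fps_X_nth le_Suc_eq simp del: of_int_power)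
  with scaled_cong_mult[OF lin lin] show ?thesis
    unfolding power2_eq_square by (rule scaled_cong_diff)
qed

text \<open>This is doubling modulo \<open>2 * h + 1\<close> up to sign. Each branch is injective,
  and the first has even values while the second has odd ones.\<close>

lemma bij_betw_double_mod_sign:
  "bij_betw (\<lambda>k. if 2 * k \<le> h then 2 * k else 2 * h + 1 - 2 * k) {1..h} {1..h::nat}"
  (is "bij_betw ?f _ _")
proof -
  have inj: "inj_on ?f {1..h}"
    by (intro inj_onI) (auto split: if_splits; presburger)
  moreover have "?f ` {1..h} \<subseteq> {1..h}"
    by auto
  ultimately show ?thesis
    unfolding bij_betw_def by (intro conjI endo_inj_surj finite_atLeastAtMost)
qed

text \<open>Doubling changes the squared inverses by the factor 4, so the coefficient is congruent
  to \<open>4 ^ (d * i + e * j)\<close> times itself. That power minus 1 lies strictly between 0 and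
  \<open>p\<close>, hence is invertible modulo \<open>p\<close>.\<close>

lemma half_product_coeff2:
  fixes u :: "nat \<Rightarrow> int"
  assumes p: "prime p" "p = 2 * h + 1"
    and u: "\<And>k. k \<in> {1..h} \<Longrightarrow> [u k * int k = 1] (mod int p)"
    and large: "4 ^ (d * i + e * j) < p" and pos: "d * i + e * j > 0"
  shows "int p dvd coeff2 (\<Prod>k=1..h.
           (1 + of_int (\<sigma> * u k ^ (2 * e)) * X_c) ^ 2 - of_int (u k ^ (2 * d)) * X_ab) i j"
proof -
  define f where "f = (\<lambda>k. if 2 * k \<le> h then 2 * k else 2 * h + 1 - 2 * k)"
  define G where
    "G = (\<lambda>s. (1 + of_int (\<sigma> * s ^ e) * X_c) ^ 2 - of_int (s ^ d) * X_ab)"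
  have f: "bij_betw f {1..h} {1..h}"
    unfolding f_def by (rule bij_betw_double_mod_sign)
  have "[u k ^ 2 = 4 * u (f k) ^ 2] (mod int p)" if k: "k \<in> {1..h}" for k
  proof -
    have fk: "f k \<in> {1..h}" using f k by (rule bij_betwE[rule_format])
    have fk2: "[int (f k) ^ 2 = (2 * int k) ^ 2] (mod int p)"
    proof (cases "2 * k \<le> h")
      case False
      then have "int (f k) = int p - 2 * int k"
        using k p(2) by (auto simp: f_def)
      then have "int (f k) ^ 2 - (2 * int k) ^ 2 = int p * (int p - 4 * int k)"
        unfolding \<open>int (f k) = int p - 2 * int k\<close> power2_eq_square by (simp add: algebra_simps)
      then show ?thesis by (simp add: cong_iff_dvd_diff)
    qed (simp add: f_def)
    have 1: "[u (f k) ^ 2 * (2 * int k) ^ 2 = 1] (mod int p)"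
    proof -
      have "[u (f k) ^ 2 * int (f k) ^ 2 = 1] (mod int p)"
        using cong_pow[OF u[OF fk], of 2] by (simp add: power_mult_distrib)
      moreover have "[u (f k) ^ 2 * int (f k) ^ 2 = u (f k) ^ 2 * (2 * int k) ^ 2] (mod int p)"
        by (rule cong_scalar_left[OF fk2])
      ultimately show ?thesis by (rule cong_trans[OF cong_sym, rotated])
    qed
    have 2: "[u k ^ 2 * int k ^ 2 = 1] (mod int p)"
      using cong_pow[OF u[OF k], of 2] by (simp add: power_mult_distrib)
    \<comment> \<open>The same product reduces to \<open>u k ^ 2\<close> by the first congruence and
      to \<open>4 * u (f k) ^ 2\<close> by the second.\<close>
    have "[u k ^ 2 * (u (f k) ^ 2 * (2 * int k) ^ 2) = u k ^ 2 * 1] (mod int p)"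
      by (rule cong_scalar_left[OF 1])
    moreover have "[4 * u (f k) ^ 2 * (u k ^ 2 * int k ^ 2) = 4 * u (f k) ^ 2 * 1] (mod int p)"
      by (rule cong_scalar_left[OF 2])
    moreover have "u k ^ 2 * (u (f k) ^ 2 * (2 * int k) ^ 2) =
        4 * u (f k) ^ 2 * (u k ^ 2 * int k ^ 2)"
      by (simp add: power_mult_distrib)
    ultimately show ?thesis
      unfolding cong_def by (metis mult.right_neutral)
  qed
  then have "scaled_cong (int p) 4 d e (\<Prod>k=1..h. G (u k ^ 2)) (\<Prod>k=1..h. G (u (f k) ^ 2))"
    unfolding G_def by (intro scaled_cong_prod scaled_cong_factor)
  \<comment> \<open>As \<open>f\<close> permutes the index set, the product is compared with
    itself.\<close>
  also have "(\<Prod>k=1..h. G (u (f k) ^ 2)) = (\<Prod>k=1..h. G (u k ^ 2))"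
    by (rule prod.reindex_bij_betw[OF f])
  finally have "[coeff2 (\<Prod>k=1..h. G (u k ^ 2)) i j =
      4 ^ (d * i + e * j) * coeff2 (\<Prod>k=1..h. G (u k ^ 2)) i j] (mod int p)"
    by (simp add: scaled_cong_def)
  then have "int p dvd (4 ^ (d * i + e * j) - 1) * coeff2 (\<Prod>k=1..h. G (u k ^ 2)) i j"
    by (subst (asm) cong_sym_eq) (simp add: cong_iff_dvd_diff algebra_simps)
  moreover have "\<not> int p dvd 4 ^ (d * i + e * j) - 1"
  proof
    assume "int p dvd 4 ^ (d * i + e * j) - 1"
    moreover have "(1::int) < 4 ^ (d * i + e * j)"
      using pos by (simp only: one_less_power)
    moreover have "(4::int) ^ (d * i + e * j) < int p"
      using large by (metis of_nat_less_iff of_nat_numeral of_nat_power)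
    ultimately show False by (auto dest: zdvd_imp_le)
  qed
  ultimately have "int p dvd coeff2 (\<Prod>k=1..h. G (u k ^ 2)) i j"
    using p(1) by (simp add: prime_dvd_mult_iff)
  then show ?thesis
    by (simp add: G_def power_mult)
qed

text \<open>Modulo \<open>q\<close> and up to degree \<open>(i, j)\<close> the series
  \<open>H\<close> is just 1, so only the term with \<open>coeff2 E i j\<close> survives in the
  convolution.\<close>

lemma coeff2_cofactor_dvd:
  assumes HE: "H * E = 1" and H0: "coeff2 E 0 0 = 1"
    and H: "\<And>k l. k \<le> i \<Longrightarrow> l \<le> j \<Longrightarrow> (k, l) \<noteq> (0, 0) \<Longrightarrow> q dvd coeff2 H k l"
    and ij: "(i, j) \<noteq> (0, 0)"
  shows "q dvd coeff2 E i j"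
proof -
  let ?t = "\<lambda>(k, l). coeff2 H k l * coeff2 E (i - k) (j - l)"
  have "coeff2 (H * E) 0 0 = 1"
    using HE by simp
  then have H00: "coeff2 H 0 0 = 1"
    using H0 by simp
  have "0 = coeff2 (H * E) i j"
    unfolding HE using ij by auto
  also have "\<dots> = sum ?t ({..i} \<times> {..j})"
    by (simp add: coeff2_mult sum.cartesian_product)
  also have "\<dots> = coeff2 E i j + sum ?t ({..i} \<times> {..j} - {(0, 0)})"
    using H00 by (subst sum.remove[of _ "(0, 0)"]) auto
  finally have "coeff2 E i j = - sum ?t ({..i} \<times> {..j} - {(0, 0)})"
    by simp
  moreover have "q dvd sum ?t ({..i} \<times> {..j} - {(0, 0)})"
    by (intro dvd_sum) (auto intro!: dvd_mult2 H)
  ultimately show ?thesis by simp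
qed

lemma word_sum_modular_inverse_dvd:
  fixes a b c m n p e :: nat
  assumes abc: "odd a" "odd b" "even c" "c > 0" and mn: "(m, n) \<noteq> (0, 0)"
    and p: "prime p" "p > 2" "p > 4 ^ ((a + b) * m + c * n)" and "e \<le> 1"
  shows "int p dvd
    word_sum a b c e (\<lambda>k. modular_inverse (int p) (int k)) (p - 1) (2 * m) n"
proof -
  define w where "w = (\<lambda>k. modular_inverse (int p) (int k))"
  obtain h where h: "p = 2 * h + 1"
    using p prime_odd_nat by (metis oddE)
  \<comment> \<open>The inverses are antisymmetric only modulo \<open>p\<close>; \<open>u\<close> is
    antisymmetric over the integers, so the closed forms apply to it.\<close>
  define u where "u = (\<lambda>k. if k \<le> h then w k else - w (p - k))"
  have w: "[w k * int k = 1] (mod int p)" if "k \<in> {1..2 * h}" for k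
  proof -
    have "\<not> p dvd k"
      using that h by (auto dest: dvd_imp_le)
    then have "coprime (int p) (int k)"
      using p(1) by (simp add: prime_imp_coprime)
    then show ?thesis
      unfolding w_def by (metis cong_modular_inverse2 coprime_commute)
  qed
  have uw: "[w k = u k] (mod int p)" if k: "k \<in> {1..2 * h}" for k
  proof (cases "k \<le> h")
    case False
    let ?v = "w (p - k)"
    have "[?v * int (p - k) = 1] (mod int p)"
      using k h by (intro w) auto
    moreover have "?v * int (p - k) = - (?v * int k) + int p * ?v"
      using k h by (simp add: of_nat_diff algebra_simps)
    ultimately have "[- (?v * int k) = 1] (mod int p)"
      unfolding cong_def by (simp only: mod_mult_self2)
    \<comment> \<open>Both \<open>w k\<close> and \<open>- ?v\<close> invert \<open>k\<close> modulo
      \<open>p\<close>, so they agree.\<close>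
    then have "[w k * - (?v * int k) = w k] (mod int p)"
      using cong_scalar_left by fastforce
    moreover have "[- ?v * (w k * int k) = - ?v * 1] (mod int p)"
      by (intro cong_scalar_left w k)
    moreover have "w k * - (?v * int k) = - ?v * (w k * int k)"
      by simp
    ultimately have "[w k = - ?v] (mod int p)"
      unfolding cong_def by (metis mult.right_neutral)
    then show ?thesis
      using False by (simp add: u_def)
  qed (simp add: u_def)
  have anti: "u (2 * h + 1 - k) = - u k" if "k \<in> {1..h}" for k
    using that h by (auto simp: u_def)
  have uinv: "[u k * int k = 1] (mod int p)" if "k \<in> {1..h}" for k
    using w[of k] that by (auto simp: u_def)
  obtain d where d: "a + b = 2 * d" using abc by (metis odd_even_add evenE)
  obtain f where f: "c = 2 * f" using abc by blast
  define P where "P = (\<lambda>\<sigma>. \<Prod>k=1..h.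
    (1 + of_int (\<sigma> * u k ^ c) * X_c) ^ 2 - of_int (u k ^ (a + b)) * X_ab)"
  have "d > 0" "f > 0"
    using abc d f by (auto elim: oddE)
  \<comment> \<open>The star case inverts the series and so needs all degrees up to
    \<open>(m, n)\<close>; smaller degrees only lower the power of 4.\<close>
  have P: "int p dvd coeff2 (P \<sigma>) k l" if "k \<le> m" "l \<le> n" "(k, l) \<noteq> (0, 0)" for \<sigma> k l
    unfolding P_def d f
  proof (rule half_product_coeff2[OF p(1) h uinv])
    have "d * k + f * l \<le> (a + b) * m + c * n"
      using that d f by (intro add_mono mult_mono) auto
    then have "(4::nat) ^ (d * k + f * l) \<le> 4 ^ ((a + b) * m + c * n)"
      by (intro power_increasing) auto
    then show "4 ^ (d * k + f * l) < p"
      using p(3) by (rule le_less_trans)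
    show "d * k + f * l > 0"
      using that(3) \<open>d > 0\<close> \<open>f > 0\<close> by auto
  qed
  have "int p dvd coeff2 (even_gf a b c e u (2 * h)) m n"
  proof (cases "e = 0")
    case True
    have "P (- 1) * even_gf a b c 0 u (2 * h) = 1"
      using even_gf_star[OF abc(1-3), of h u, OF anti] by (simp add: P_def)
    then show ?thesis
      unfolding True by (rule coeff2_cofactor_dvd)
        (use mn P in \<open>auto simp: even_gf_def word_sum_0_0\<close>)
  next
    case False
    then have "even_gf a b c e u (2 * h) = P 1"
      using even_gf_nonstar[OF abc(1-3), of h u, OF anti] \<open>e \<le> 1\<close> by (simp add: P_def le_Suc_eq)
    then show ?thesis using P mn by simp
  qed
  moreover have "[word_sum a b c e w (2 * h) (2 * m) n = word_sum a b c e u (2 * h) (2 * m) n]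
      (mod int p)"
    unfolding word_sum_def by (intro cong_sum trunc_sum_cong_mod uw)
  ultimately show ?thesis
    using h by (simp add: w_def even_gf_def cong_dvd_iff)
qed

section \<open>Passage to the quotient ring\<close>

lemma sum_abs_ring_A: "(\<Sum>x\<in>S. abs_ring_A (f x)) = abs_ring_A (\<lambda>p. \<Sum>x\<in>S. f x p)"
  by (induction S rule: infinite_finite_induct)
    (auto simp: zero_ring_A_def plus_ring_A.abs_eq)

lemma abs_ring_A_eq_0:
  assumes "\<And>p. prime p \<Longrightarrow> p > B \<Longrightarrow> int p dvd f p"
  shows "abs_ring_A f = 0"
proof -
  have "{p. prime p \<and> \<not> [f p = 0] (mod int p)} \<subseteq> {..B}"
    using assms by (auto simp: cong_0_iff not_less[symmetric])
  then have "almost_cong f (\<lambda>_. 0)"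
    unfolding almost_cong_iff_finite by (rule finite_subset) simp
  then show ?thesis
    by (simp add: zero_ring_A_def ring_A.abs_eq_iff)
qed

theorem theorem1p4:
  fixes a b c m n :: nat
  assumes "odd a" and "odd b" and "even c" and "c > 0" and "(m, n) \<noteq> (0, 0)"
  shows "(\<Sum>ns \<in> weak_compositions (2 * m + 1) n. zeta_A (interleaved_args a b c m ns)) =
           (\<Sum>ns \<in> weak_compositions (2 * m + 1) n. zeta_star_A (interleaved_args a b c m ns))
       \<and> (\<Sum>ns \<in> weak_compositions (2 * m + 1) n. zeta_star_A (interleaved_args a b c m ns)) = 0"
proof -
  \<comment> \<open>Exceeding 2 makes \<open>p\<close> odd; the other bound keeps the scaling
    factors below \<open>p\<close>.\<close>
  let ?B = "max 2 (4 ^ ((a + b) * m + c * n))"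
  let ?S = "weak_compositions (2 * m + 1) n"
  let ?w = "\<lambda>p k. modular_inverse (int p) (int k)"
  have sum_eq: "(\<Sum>ns\<in>?S. trunc_sum e (?w p) (p - 1) (interleaved_args a b c m ns)) =
      word_sum a b c e (?w p) (p - 1) (2 * m) n" for e p
    unfolding word_sum_def Suc_eq_plus1
    by (intro sum.cong refl arg_cong[where f = "trunc_sum e (?w p) (p - 1)"]
        interleaved_args_eq_interleave) (simp add: weak_compositions_def)
  have "(\<Sum>ns\<in>?S. zeta_A (interleaved_args a b c m ns)) = 0"
    unfolding zeta_A.abs_eq sum_abs_ring_A
  proof (rule abs_ring_A_eq_0[of ?B])
    fix p :: nat assume "prime p" "p > ?B"
    then show "int p dvd (\<Sum>ns\<in>?S. zeta_trunc p (interleaved_args a b c m ns))"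
      using word_sum_modular_inverse_dvd[OF assms, of p 1]
      by (simp only: zeta_trunc_eq_trunc_sum prime_gt_0_nat sum_eq)
  qed
  moreover have "(\<Sum>ns\<in>?S. zeta_star_A (interleaved_args a b c m ns)) = 0"
    unfolding zeta_star_A.abs_eq sum_abs_ring_A
  proof (rule abs_ring_A_eq_0[of ?B])
    fix p :: nat assume "prime p" "p > ?B"
    then show "int p dvd (\<Sum>ns\<in>?S. zeta_star_trunc p (interleaved_args a b c m ns))"
      using word_sum_modular_inverse_dvd[OF assms, of p 0]
      by (simp only: zeta_star_trunc_eq_trunc_sum prime_gt_0_nat sum_eq)
  qed
  ultimately show ?thesis by simp
qed

end
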